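(* Let $m\geq 2$ and $1\leq i\leq m-1$. Then $$\frac{d_i(m)^2}{d_{i-1}(m)d_{i+1}(m)}>\frac{(m-i+1)(i+1)(m+i)}{(m-i)\,i\,(m+i+1)}.$$
   Context: For integers $m\geq 0$, the Boros-Moll polynomial is $P_m(a)=2^{-2m}\sum_{k}2^k\binom{2m-2k}{m-k}\binom{m+k}{k}(a+1)^k=\sum_{i=0}^m d_i(m)a^i$, so that $d_i(m)=2^{-2m}\sum_{k=0}^m 2^k\binom{2m-2k}{m-k}\binom{m+k}{m}\binom{k}{i}$ for $0\le i\le m$. These coefficients are positive. *)

theory Defs
  imports Complex_Main "HOL-Computational_Algebra.Polynomial"
begin

definition boros_moll :: "nat \<Rightarrow> real poly" where
  "boros_moll m = smult (1 / 2 ^ (2 * m))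
     (\<Sum>k\<le>m. smult (2 ^ k * real ((2 * m - 2 * k) choose (m - k)) * real ((m + k) choose k))
        ([:1, 1:] ^ k))"

definition boros_moll_coeff :: "nat \<Rightarrow> nat \<Rightarrow> real" where
  "boros_moll_coeff i m = coeff (boros_moll m) i"

lemma coeff_linear_1_power: "coeff ([:1, 1:] ^ k :: real poly) i = real (k choose i)"
  by (cases "i \<le> k") (simp_all add: coeff_linear_poly_power binomial_eq_0 coeff_eq_0 degree_linear_power)

lemma boros_moll_coeff_eq:
  "boros_moll_coeff i m = 1 / 2 ^ (2 * m) *
     (\<Sum>k\<le>m. 2 ^ k * real ((2 * m - 2 * k) choose (m - k)) * real ((m + k) choose m) * real (k choose i))"
proof -
  have "(m + k) choose k = (m + k) choose m" for k
    using binomial_symmetric[of k "m + k"] by simp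
  then show ?thesis
    by (simp add: boros_moll_coeff_def boros_moll_def coeff_sum coeff_linear_1_power)
qed

lemma boros_moll_eq_sum:
  "poly (boros_moll m) a = (\<Sum>i\<le>m. boros_moll_coeff i m * a ^ i)"
proof -
  have "degree (boros_moll m) \<le> m"
  proof (rule degree_le, intro allI impI)
    fix i assume "m < i"
    then have "boros_moll_coeff i m = 0"
      unfolding boros_moll_coeff_eq by (simp add: binomial_eq_0)
    then show "coeff (boros_moll m) i = 0"
      by (simp add: boros_moll_coeff_def)
  qed
  then show ?thesis
    unfolding poly_altdef boros_moll_coeff_def
    by (intro sum.mono_neutral_left) (auto simp: coeff_eq_0)
qed

lemma boros_moll_coeff_pos:
  assumes "i \<le> m"
  shows "boros_moll_coeff i m > 0"
proof -
  have "0 < (\<Sum>k\<le>m. 2 ^ k * real ((2 * m - 2 * k) choose (m - k)) * real ((m + k) choose m) * real (k choose i))"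
    by (rule sum_pos2[of _ m]) (use assms in auto)
  then show ?thesis
    by (simp add: boros_moll_coeff_eq)
qed

end

theory Submission
  imports Defs
begin

text \<open>
  Write \<open>P\<^sub>m(a) = Q(a + 1)\<close>. The coefficients of \<open>Q\<close> have a rational term ratio, so \<open>Q\<close>
  satisfies a differential equation of hypergeometric type; translating it by \<open>1\<close> gives
  \<open>(1 - a\<^sup>2) P'' - (2m + 1 + 2a) P' + m (m + 1) P = 0\<close>, that is, a three-term recurrence for the
  coefficients \<open>d\<^sub>i\<close> of \<open>P\<^sub>m\<close>. Eliminating \<open>d\<^sub>i\<^sub>+\<^sub>1\<close> turns the claim into a quadratic inequality in
  \<open>(m-i+1) (m+i) d\<^sub>i\<^sub>-\<^sub>1\<close> whose roots are \<open>i (m-i) d\<^sub>i\<close> and \<open>i (m+i+1) d\<^sub>i\<close>. That the larger root is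
  exceeded amounts, by the recurrence, to \<open>(i+1) d\<^sub>i\<^sub>+\<^sub>1 < (m-i) d\<^sub>i\<close>, which holds because
  \<open>m P - (a + 1) P'\<close> has nonnegative coefficients in powers of \<open>a + 1\<close>.
\<close>

definition hypergeometric_op :: "'a::idom poly \<Rightarrow> 'a poly \<Rightarrow> 'a \<Rightarrow> 'a poly \<Rightarrow> 'a poly" where
  "hypergeometric_op \<sigma> \<tau> l p = \<sigma> * pderiv (pderiv p) + \<tau> * pderiv p + smult l p"

lemma coeff_hypergeometric_op:
  "coeff (hypergeometric_op [:s\<^sub>0, s\<^sub>1, s\<^sub>2:] [:t\<^sub>0, t\<^sub>1:] l p) n =
     s\<^sub>0 * (of_nat n + 1) * (of_nat n + 2) * coeff p (n + 2)
   + (s\<^sub>1 * of_nat n + t\<^sub>0) * (of_nat n + 1) * coeff p (n + 1)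
   + (s\<^sub>2 * of_nat n * (of_nat n - 1) + t\<^sub>1 * of_nat n + l) * coeff p n"
proof (cases n)
  case 0
  then show ?thesis
    by (simp add: hypergeometric_op_def coeff_pderiv algebra_simps numeral_2_eq_2)
next
  case (Suc k)
  then show ?thesis
    by (cases k) (simp_all add: hypergeometric_op_def coeff_pderiv algebra_simps numeral_2_eq_2)
qed

lemma hypergeometric_op_pcompose_shift:
  "pcompose (hypergeometric_op \<sigma> \<tau> l p) [:c, 1:] =
     hypergeometric_op (pcompose \<sigma> [:c, 1:]) (pcompose \<tau> [:c, 1:]) l (pcompose p [:c, 1:])"
  by (simp add: hypergeometric_op_def pderiv_pcompose pderiv_pCons pcompose_add pcompose_mult
      pcompose_smult)

lemma pcompose_monom: "pcompose (monom c n) q = smult c (q ^ n)"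
  by (induction n) (simp_all add: monom_0 monom_Suc pcompose_pCons)

lemma coeff_Suc_less_if_pos_shifted_coeffs:
  fixes w :: "nat \<Rightarrow> real"
  assumes pos: "\<And>k. k \<le> m \<Longrightarrow> 0 < w k"
    and p: "p = (\<Sum>k\<le>m. smult (w k) ([:1, 1:] ^ k))"
    and "j < m"
  shows "(real j + 1) * coeff p (j + 1) < (real m - real j) * coeff p j"
proof -
  have coeff_p: "coeff p i = (\<Sum>k\<le>m. w k * real (k choose i))" for i
    by (simp add: p coeff_sum coeff_linear_1_power)
  have absorb: "(real j + 1) * real (k choose (j + 1)) = (real k - real j) * real (k choose j)" for k
    using gbinomial_mult_1[of "real k" j] by (simp add: binomial_gbinomial algebra_simps)
  have "(real m - real j) * coeff p j - (real j + 1) * coeff p (j + 1)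
      = (\<Sum>k\<le>m. w k * ((real m - real j) * real (k choose j)
          - (real j + 1) * real (k choose (j + 1))))"
    unfolding coeff_p by (simp add: sum_distrib_left sum_subtractf right_diff_distrib mult.left_commute)
  also have "\<dots> = (\<Sum>k\<le>m. (real m - real k) * (w k * real (k choose j)))"
    unfolding absorb by (simp add: algebra_simps)
  also have "\<dots> > 0"
    using pos \<open>j < m\<close> by (intro sum_pos2[of _ j]) (auto simp: less_imp_le)
  finally show ?thesis by simp
qed

definition boros_moll_weight :: "nat \<Rightarrow> nat \<Rightarrow> real" where
  "boros_moll_weight m k =
     2 ^ k * real ((2 * m - 2 * k) choose (m - k)) * real ((m + k) choose k) / 2 ^ (2 * m)"

lemma boros_moll_weight_pos: "k \<le> m \<Longrightarrow> 0 < boros_moll_weight m k"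
  by (simp add: boros_moll_weight_def)

lemma boros_moll_eq_sum_weight:
  "boros_moll m = (\<Sum>k\<le>m. smult (boros_moll_weight m k) ([:1, 1:] ^ k))"
  by (rule poly_eqI) (simp add: boros_moll_def boros_moll_weight_def coeff_sum sum_divide_distrib)

lemma central_binomial_Suc:
  "Suc n * ((2 * Suc n) choose Suc n) = 2 * (2 * n + 1) * ((2 * n) choose n)"
proof -
  have "Suc n * ((2 * Suc n) choose Suc n) = 2 * (Suc n * ((2 * n + 1) choose n))"
    using Suc_times_binomial[of n "2 * n + 1"] by simp
  also have "Suc n * ((2 * n + 1) choose n) = (2 * n + 1) * ((2 * n) choose n)"
    using binomial_absorb_comp[of "2 * n + 1" n] by simp
  finally show ?thesis by simp
qed

lemma boros_moll_weight_Suc: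
  assumes "k < m"
  shows "(real k + 1) * (2 * real m - 2 * real k - 1) * boros_moll_weight m (k + 1)
    = (real m - real k) * (real m + real k + 1) * boros_moll_weight m k"
proof -
  obtain n where m_eq: "m = Suc (k + n)"
    using assms less_iff_Suc_add by auto
  then have real_m_eq: "real m = real k + real n + 1" by simp
  define B where "B i = real ((2 * i) choose i)" for i
  define C where "C i = real ((m + i) choose i)" for i
  have B_Suc: "(real n + 1) * B (Suc n) = 2 * (2 * real n + 1) * B n"
    using arg_cong[OF central_binomial_Suc[of n], of real]
    unfolding B_def of_nat_mult by (simp add: algebra_simps)
  have C_Suc: "(real k + 1) * C (k + 1) = (real m + real k + 1) * C k"
    using arg_cong[OF Suc_times_binomial[of k "m + k"], of real]
    unfolding C_def of_nat_mult by (simp add: algebra_simps)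
  have weight_eq: "boros_moll_weight m k = 2 ^ k * B (Suc n) * C k / 2 ^ (2 * m)"
    "boros_moll_weight m (k + 1) = 2 * 2 ^ k * B n * C (k + 1) / 2 ^ (2 * m)"
    using m_eq by (simp_all add: boros_moll_weight_def B_def C_def algebra_simps)
  have "(real k + 1) * (2 * real m - 2 * real k - 1) * boros_moll_weight m (k + 1)
      = 2 ^ k * (2 * (2 * real n + 1) * B n) * ((real k + 1) * C (k + 1)) / 2 ^ (2 * m)"
    unfolding weight_eq by (simp add: real_m_eq)
  also have "\<dots> = 2 ^ k * ((real n + 1) * B (Suc n)) * ((real m + real k + 1) * C k) / 2 ^ (2 * m)"
    by (simp only: B_Suc C_Suc)
  also have "\<dots> = (real m - real k) * (real m + real k + 1) * boros_moll_weight m k"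
    unfolding weight_eq by (simp add: real_m_eq)
  finally show ?thesis .
qed

definition shifted_boros_moll :: "nat \<Rightarrow> real poly" where
  "shifted_boros_moll m = (\<Sum>k\<le>m. monom (boros_moll_weight m k) k)"

lemma coeff_shifted_boros_moll:
  "coeff (shifted_boros_moll m) k = (if k \<le> m then boros_moll_weight m k else 0)"
  by (simp add: shifted_boros_moll_def coeff_sum)

lemma boros_moll_eq_pcompose_shifted: "boros_moll m = pcompose (shifted_boros_moll m) [:1, 1:]"
  by (simp add: boros_moll_eq_sum_weight shifted_boros_moll_def pcompose_sum pcompose_monom)

lemma hypergeometric_op_shifted_boros_moll:
  "hypergeometric_op [:0, 2, -1:] [:1 - 2 * real m, -2:] (real m * (real m + 1))
     (shifted_boros_moll m) = 0"
  (is "?L = 0")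
proof (rule poly_eqI)
  fix k
  have "coeff ?L k = (real m - real k) * (real m + real k + 1) * coeff (shifted_boros_moll m) k
      - (real k + 1) * (2 * real m - 2 * real k - 1) * coeff (shifted_boros_moll m) (k + 1)"
    unfolding coeff_hypergeometric_op by algebra
  also have "\<dots> = 0"
    using boros_moll_weight_Suc[of k m]
    by (cases k m rule: linorder_cases) (auto simp: coeff_shifted_boros_moll)
  finally show "coeff ?L k = coeff 0 k" by simp
qed

lemma hypergeometric_op_boros_moll:
  "hypergeometric_op [:1, 0, -1:] [:- 1 - 2 * real m, -2:] (real m * (real m + 1))
     (boros_moll m) = 0"
  using arg_cong[OF hypergeometric_op_shifted_boros_moll[of m], of "\<lambda>p. pcompose p [:1, 1:]"]
  by (simp add: hypergeometric_op_pcompose_shift boros_moll_eq_pcompose_shifted pcompose_pCons)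

lemma boros_moll_coeff_recurrence:
  "(real j + 1) * (real j + 2) * boros_moll_coeff (j + 2) m
    = (real j + 1) * (2 * real m + 1) * boros_moll_coeff (j + 1) m
      - (real m - real j) * (real m + real j + 1) * boros_moll_coeff j m"
  using arg_cong[OF hypergeometric_op_boros_moll[of m], of "\<lambda>p. coeff p j"]
  unfolding coeff_hypergeometric_op boros_moll_coeff_def[symmetric] by (simp add: algebra_simps)

lemma boros_moll_coeff_Suc_less:
  "j < m \<Longrightarrow> (real j + 1) * boros_moll_coeff (j + 1) m < (real m - real j) * boros_moll_coeff j m"
  unfolding boros_moll_coeff_def
  by (rule coeff_Suc_less_if_pos_shifted_coeffs[OF boros_moll_weight_pos boros_moll_eq_sum_weight])

lemma boros_moll_coeff_ratio_greater:
  assumes "j + 1 < m"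
  shows "(real j + 1) * (real m + real j + 2) * boros_moll_coeff (j + 1) m
    < (real m - real j) * (real m + real j + 1) * boros_moll_coeff j m"
proof -
  have "(real m - real j) * (real m + real j + 1) * boros_moll_coeff j m
      - (real j + 1) * (real m + real j + 2) * boros_moll_coeff (j + 1) m
      = (real j + 1) * ((real m - real (j + 1)) * boros_moll_coeff (j + 1) m
          - (real (j + 1) + 1) * boros_moll_coeff (j + 2) m)"
    using boros_moll_coeff_recurrence[of j m] by (simp add: algebra_simps)
  also have "\<dots> > 0"
    using boros_moll_coeff_Suc_less[OF assms] by (intro mult_pos_pos) simp_all
  finally show ?thesis by simp
qed

lemma turan_quotient_greater_if_recurrence:
  fixes M I a b c :: real
  assumes "0 < I" "I < M" and pos: "0 < a" "0 < b" "0 < c"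
    and rec: "I * (I + 1) * c = I * (2 * M + 1) * b - (M - I + 1) * (M + I) * a"
    and ratio: "I * (M + I + 1) * b < (M - I + 1) * (M + I) * a"
  shows "(M - I + 1) * (I + 1) * (M + I) / ((M - I) * I * (M + I + 1)) < b\<^sup>2 / (a * c)"
proof -
  define y where "y = (M - I + 1) * (M + I) * a"
  have "I * (M - I) * b \<le> I * (M + I + 1) * b"
    using assms by (intro mult_right_mono mult_left_mono) auto
  with ratio have "0 < (y - I * (M + I + 1) * b) * (y - I * (M - I) * b)"
    unfolding y_def by (intro mult_pos_pos) simp_all
  also have "\<dots> = I * ((M - I) * I * (M + I + 1) * b\<^sup>2) - y * (I * (2 * M + 1) * b - y)"
    by algebra
  also have "\<dots> = I * ((M - I) * I * (M + I + 1) * b\<^sup>2 - (M - I + 1) * (I + 1) * (M + I) * (a * c))"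
    unfolding y_def rec[symmetric] by algebra
  finally have "(M - I + 1) * (I + 1) * (M + I) * (a * c) < (M - I) * I * (M + I + 1) * b\<^sup>2"
    using \<open>0 < I\<close> by (simp add: zero_less_mult_iff)
  then show ?thesis
    using \<open>0 < I\<close> \<open>I < M\<close> pos by (simp add: divide_less_eq less_divide_eq mult_ac)
qed

theorem theorem1p2:
  fixes m i :: nat
  assumes "m \<ge> 2" and "1 \<le> i" and "i \<le> m - 1"
  shows "(boros_moll_coeff i m)\<^sup>2 / (boros_moll_coeff (i - 1) m * boros_moll_coeff (i + 1) m)
    > ((real m - real i + 1) * (real i + 1) * (real m + real i))
        / ((real m - real i) * real i * (real m + real i + 1))"
proof (rule turan_quotient_greater_if_recurrence)
  have pred_i: "i - 1 + 1 = i" "i - 1 + 2 = i + 1" "real (i - 1) = real i - 1" and "i < m"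
    using assms by simp_all
  show "0 < real i" "real i < real m"
    using assms \<open>i < m\<close> by simp_all
  show "0 < boros_moll_coeff (i - 1) m" "0 < boros_moll_coeff i m" "0 < boros_moll_coeff (i + 1) m"
    using \<open>i < m\<close> by (simp_all add: boros_moll_coeff_pos)
  show "real i * (real i + 1) * boros_moll_coeff (i + 1) m =
      real i * (2 * real m + 1) * boros_moll_coeff i m
      - (real m - real i + 1) * (real m + real i) * boros_moll_coeff (i - 1) m"
    using boros_moll_coeff_recurrence[of "i - 1" m] unfolding pred_i by (simp add: algebra_simps)
  show "real i * (real m + real i + 1) * boros_moll_coeff i m
      < (real m - real i + 1) * (real m + real i) * boros_moll_coeff (i - 1) m"
    using boros_moll_coeff_ratio_greater[of "i - 1" m] \<open>i < m\<close> unfolding pred_i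
    by (simp add: algebra_simps)
qed

end
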